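(* Let $0 < \alpha, p, q < 1$ and $1 < c < 2$. For all sufficiently large $N$ there exist $N$-dimensional $p$-$c$-chaotic Boolean networks that are $p$-$\alpha$-$q$-decoherent (i.e., exhibit $p$-$\alpha$-$q$-decoherence).
   Context: Write $[N]=\{1,\dots,N\}$. An $N$-dimensional Boolean network is a pair $(2^{[N]},f)$ with $f:\{0,1\}^{[N]}\to\{0,1\}^{[N]}$; it is updated synchronously in discrete time by $\vec{s}(t+1)=f(\vec{s}(t))$, $t=0,1,2,\dots$. An attractor is a periodic orbit of $f$ (including fixed points); its length is the number of states in it. No restriction (such as cooperativity or a bound on the number of inputs) is imposed on $f$ here. The Hamming distance $H(\vec{s},\vec{s}^{\,*})$ is the number of coordinates in which $\vec{s}$ and $\vec{s}^{\,*}$ differ. A randomly chosen initial condition is uniformly distributed on $\{0,1\}^{[N]}$; a random one-bit flip changes the value of one coordinate chosen uniformly from $[N]$, independently of the state. The network is $p$-$c$-chaotic if with probability $>p$ the trajectory of a randomly chosen initial condition reaches an attractor of length $>c^N$. The network exhibits $p$-$\alpha$-$q$-decoherence if with probability $\ge p$ a random one-bit flip $\vec{s}^{\,*}(0)$ in a randomly chosen initial condition $\vec{s}(0)$ results in trajectories with the property that for all sufficiently large $t^*>0$, the proportion of (integer) times $t\in[0,t^*]$ for which $H(\vec{s}(t),\vec{s}^{\,*}(t))\ge\alpha N$ is at least $q$. *)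

theory Defs
  imports "HOL-Probability.Probability" "HOL-Library.FuncSet"
begin

text \<open>
  The dimension \<open>N\<close> is quantified inside statements, so it is a natural number rather than an
  index type. A state is a function on \<open>{1..N}\<close> with Boolean values, extended by
  \<open>undefined\<close> outside \<open>{1..N}\<close>, so that \<open>states N\<close> has exactly \<open>2 ^ N\<close> elements.
\<close>

definition states :: "nat \<Rightarrow> (nat \<Rightarrow> bool) set" where
  "states N = ({1..N} \<rightarrow>\<^sub>E (UNIV :: bool set))"

definition boolean_network :: "nat \<Rightarrow> ((nat \<Rightarrow> bool) \<Rightarrow> (nat \<Rightarrow> bool)) \<Rightarrow> bool" where
  "boolean_network N f \<longleftrightarrow> f \<in> states N \<rightarrow> states N"

definition trajectory :: "((nat \<Rightarrow> bool) \<Rightarrow> (nat \<Rightarrow> bool)) \<Rightarrow> (nat \<Rightarrow> bool) \<Rightarrow> nat \<Rightarrow> (nat \<Rightarrow> bool)" where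
  "trajectory f s t = (f ^^ t) s"

definition attractor :: "nat \<Rightarrow> ((nat \<Rightarrow> bool) \<Rightarrow> (nat \<Rightarrow> bool)) \<Rightarrow> (nat \<Rightarrow> bool) set \<Rightarrow> bool" where
  "attractor N f A \<longleftrightarrow>
     (\<exists>s\<in>states N. (\<exists>k>0. trajectory f s k = s) \<and> A = range (trajectory f s))"

definition reaches ::
  "((nat \<Rightarrow> bool) \<Rightarrow> (nat \<Rightarrow> bool)) \<Rightarrow> (nat \<Rightarrow> bool) \<Rightarrow> (nat \<Rightarrow> bool) set \<Rightarrow> bool" where
  "reaches f s A \<longleftrightarrow> (\<exists>t. trajectory f s t \<in> A)"

definition hamming :: "nat \<Rightarrow> (nat \<Rightarrow> bool) \<Rightarrow> (nat \<Rightarrow> bool) \<Rightarrow> nat" where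
  "hamming N s s' = card {i \<in> {1..N}. s i \<noteq> s' i}"

definition flip :: "nat \<Rightarrow> (nat \<Rightarrow> bool) \<Rightarrow> (nat \<Rightarrow> bool)" where
  "flip i s = s(i := \<not> s i)"

definition random_state :: "nat \<Rightarrow> (nat \<Rightarrow> bool) pmf" where
  "random_state N = pmf_of_set (states N)"

text \<open>
  The flipped coordinate is independent of the state, hence the product distribution. For
  \<open>N = 0\<close> there is no coordinate to flip and \<open>pmf_of_set {1..N}\<close> is unspecified; the notion is
  meant for \<open>N \<ge> 1\<close>.
\<close>

definition random_state_and_coordinate :: "nat \<Rightarrow> ((nat \<Rightarrow> bool) \<times> nat) pmf" where
  "random_state_and_coordinate N = pair_pmf (random_state N) (pmf_of_set {1..N})"

definition chaotic :: "real \<Rightarrow> real \<Rightarrow> nat \<Rightarrow> ((nat \<Rightarrow> bool) \<Rightarrow> (nat \<Rightarrow> bool)) \<Rightarrow> bool" where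
  "chaotic p c N f \<longleftrightarrow>
     measure_pmf.prob (random_state N)
       {s. \<exists>A. attractor N f A \<and> reaches f s A \<and> real (card A) > c ^ N} > p"

definition far_apart_proportion ::
  "real \<Rightarrow> nat \<Rightarrow> ((nat \<Rightarrow> bool) \<Rightarrow> (nat \<Rightarrow> bool)) \<Rightarrow> (nat \<Rightarrow> bool) \<Rightarrow> (nat \<Rightarrow> bool) \<Rightarrow> nat \<Rightarrow> real" where
  "far_apart_proportion \<alpha> N f s s' T =
     real (card {t \<in> {0..T}. real (hamming N (trajectory f s t) (trajectory f s' t)) \<ge> \<alpha> * real N})
     / real (card {0..T})"

definition decoherent ::
  "real \<Rightarrow> real \<Rightarrow> real \<Rightarrow> nat \<Rightarrow> ((nat \<Rightarrow> bool) \<Rightarrow> (nat \<Rightarrow> bool)) \<Rightarrow> bool" where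
  "decoherent p \<alpha> q N f \<longleftrightarrow>
     measure_pmf.prob (random_state_and_coordinate N)
       {(s, i). \<forall>\<^sub>F T in sequentially. far_apart_proportion \<alpha> N f s (flip i s) T \<ge> q} \<ge> p"

end

theory Submission
  imports Defs "HOL-Real_Asymp.Real_Asymp"
begin

text \<open>
  Since \<open>c < 2\<close>, a cycle longer than \<open>c ^ N\<close> may still occupy a vanishing proportion of the
  \<open>2 ^ N\<close> states. Take two disjoint cycles of such a length \<open>L\<close>, the second being the
  coordinatewise complement of the first, traversed in step with it (locale \<open>twin_cycles\<close>). Every
  state off the cycles is sent to the starting point of the first cycle if it has an even number of
  true coordinates, and to the starting point of the second one otherwise.

  All trajectories then end in one of the two cycles, so the network is chaotic with
  probability one. A one-bit flip always changes the parity. Hence, whenever neither the initial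
  state nor its flip lies on a cycle, the two trajectories enter different cycles at time \<open>1\<close>
  and are complementary, that is, at the maximal distance \<open>N\<close>, at all times from then
  on (\<open>hamming_trajectories\<close>). By a union bound the exceptional pairs of a state and a coordinate
  have proportion at most \<open>4 L / 2 ^ N\<close> (\<open>prob_off_cycles\<close>), which tends to \<open>0\<close>. All
  constants \<open>\<alpha>, p, q\<close> below \<open>1\<close> can therefore be reached simultaneously.
\<close>

section \<open>Flips, complements and parity\<close>

lemma finite_states [simp]: "finite (states N)"
  by (simp add: states_def finite_PiE)

lemma card_states: "card (states N) = 2 ^ N"
  by (simp add: states_def card_PiE)

lemma states_nonempty [simp]: "states N \<noteq> {}"
  using card_states[of N] by force

lemma flip_flip [simp]: "flip i (flip i s) = s"
  by (simp add: flip_def)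

lemma flip_in_states: "i \<in> {1..N} \<Longrightarrow> s \<in> states N \<Longrightarrow> flip i s \<in> states N"
  by (auto simp: states_def flip_def PiE_def extensional_def)

definition complement :: "nat \<Rightarrow> (nat \<Rightarrow> bool) \<Rightarrow> (nat \<Rightarrow> bool)" where
  "complement N s = (\<lambda>i\<in>{1..N}. \<not> s i)"

lemma complement_in_states [simp]: "complement N s \<in> states N"
  by (simp add: complement_def states_def)

lemma complement_complement: "s \<in> states N \<Longrightarrow> complement N (complement N s) = s"
  by (auto simp: complement_def states_def PiE_def extensional_def fun_eq_iff)

lemma hamming_complement:
  "hamming N s (complement N s) = N" "hamming N (complement N s) s = N"
proof -
  have "{i \<in> {1..N}. s i \<noteq> complement N s i} = {1..N}"
    "{i \<in> {1..N}. complement N s i \<noteq> s i} = {1..N}"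
    by (auto simp: complement_def)
  then show "hamming N s (complement N s) = N" "hamming N (complement N s) s = N"
    by (simp_all add: hamming_def)
qed

definition odd_parity :: "nat \<Rightarrow> (nat \<Rightarrow> bool) \<Rightarrow> bool" where
  "odd_parity N s \<longleftrightarrow> odd (card {i \<in> {1..N}. s i})"

lemma odd_parity_flip:
  assumes i: "i \<in> {1..N}"
  shows "odd_parity N (flip i s) \<longleftrightarrow> \<not> odd_parity N s"
proof -
  have *: "card {j \<in> {1..N}. u j} = Suc (card {j \<in> {1..N}. flip i u j})" if "u i" for u
  proof -
    have "{j \<in> {1..N}. u j} = insert i {j \<in> {1..N}. flip i u j}"
      using i that by (auto simp: flip_def)
    then show ?thesis
      using that by (simp add: flip_def)
  qed
  show ?thesis
  proof (cases "s i")
    case True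
    then show ?thesis using *[of s] by (simp add: odd_parity_def)
  next
    case False
    then have "flip i s i" by (simp add: flip_def)
    then show ?thesis using *[of "flip i s"] by (simp add: odd_parity_def)
  qed
qed

text \<open>
  Flipping the first coordinate matches the states that are false there with those that are true
  there. These two halves are the room for a cycle and for its complement.
\<close>

lemma card_states_first_false:
  assumes "N \<ge> 1"
  shows "2 * card {s \<in> states N. \<not> s 1} = 2 ^ N"
proof -
  have "bij_betw (flip 1) {s \<in> states N. \<not> s 1} {s \<in> states N. s 1}"
    by (rule bij_betw_byWitness[where f' = "flip 1"])
      (use assms in \<open>auto intro!: flip_in_states simp del: One_nat_def, auto simp: flip_def\<close>)
  then have "card {s \<in> states N. \<not> s 1} = card {s \<in> states N. s 1}"
    by (rule bij_betw_same_card)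
  moreover have "card (states N) = card ({s \<in> states N. \<not> s 1} \<union> {s \<in> states N. s 1})"
    by (rule arg_cong[where f = card]) auto
  moreover have "\<dots> = card {s \<in> states N. \<not> s 1} + card {s \<in> states N. s 1}"
    by (rule card_Un_disjoint) auto
  ultimately show ?thesis by (simp add: card_states)
qed

section \<open>A network with two complementary cycles\<close>

text \<open>
  The condition on the first coordinate keeps the cycle through the points \<open>e k\<close> disjoint from its
  complement.
\<close>

locale twin_cycles =
  fixes N L :: nat and e :: "nat \<Rightarrow> nat \<Rightarrow> bool"
  assumes N_pos: "N \<ge> 1" and L_pos: "L > 0"
    and inj_e: "inj_on e {..<L}"
    and e_states: "k < L \<Longrightarrow> e k \<in> states N"
    and e_first: "k < L \<Longrightarrow> \<not> e k 1"
begin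

definition point :: "bool \<Rightarrow> nat \<Rightarrow> nat \<Rightarrow> bool" where
  "point b k = (if b then complement N (e (k mod L)) else e (k mod L))"

definition cycle_states :: "(nat \<Rightarrow> bool) set" where
  "cycle_states = {point b k | b k. True}"

definition step :: "(nat \<Rightarrow> bool) \<Rightarrow> nat \<Rightarrow> bool" where
  "step s = (if s \<in> cycle_states
     then (let (b, k) = (SOME (b, k). s = point b k) in point b (Suc k))
     else point (odd_parity N s) 0)"

lemma mod_L [simp]: "k mod L < L"
  using L_pos by simp

lemma point_in_states: "point b k \<in> states N"
  by (simp add: point_def e_states)

lemma point_first: "point b k 1 = b"
  using N_pos e_first[of "k mod L"] by (auto simp: point_def complement_def)

lemma point_eq_iff: "point b j = point b' k \<longleftrightarrow> b = b' \<and> j mod L = k mod L"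
proof
  assume eq: "point b j = point b' k"
  then have "b = b'" by (metis point_first)
  moreover have "e (j mod L) = e (k mod L)"
    using eq \<open>b = b'\<close> complement_complement[OF e_states[OF mod_L]]
    by (auto simp: point_def split: if_splits) metis
  ultimately show "b = b' \<and> j mod L = k mod L"
    using inj_e by (auto simp: inj_on_def)
qed (auto simp: point_def)

lemma point_mod [simp]: "point b (k mod L) = point b k"
  by (simp add: point_eq_iff)

text \<open>
  The cyclic successor is well defined: a point determines its cycle, and its position up to a
  multiple of \<open>L\<close>.
\<close>

lemma step_point: "step (point b k) = point b (Suc k)"
proof -
  have "\<exists>x. case x of (b', k') \<Rightarrow> point b k = point b' k'" by auto
  then obtain b' k' where
    *: "(SOME (b', k'). point b k = point b' k') = (b', k')" "point b k = point b' k'"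
    by (metis (mono_tags, lifting) case_prod_beta prod.collapse someI_ex)
  then have "b = b'" "k mod L = k' mod L" by (simp_all add: point_eq_iff)
  then have "Suc k mod L = Suc k' mod L" by (metis mod_Suc_eq)
  with * \<open>b = b'\<close> show ?thesis
    by (auto simp: step_def cycle_states_def point_eq_iff)
qed

lemma boolean_network_step: "boolean_network N step"
  by (auto simp: boolean_network_def step_def point_in_states split: prod.split)

lemma trajectory_point: "trajectory step (point b k) t = point b (k + t)"
  by (induction t) (simp_all add: trajectory_def step_point)

lemma trajectory_off_cycles:
  assumes "s \<notin> cycle_states"
  shows "trajectory step s (Suc t) = point (odd_parity N s) t"
  using assms trajectory_point[of "odd_parity N s" 0 t]
  by (simp add: trajectory_def funpow_Suc_right step_def del: funpow.simps)

lemma range_point: "range (point b) = point b ` {..<L}"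
  by (auto intro!: image_eqI[where x = "_ mod L"])

lemma attractor_cycle: "attractor N step (range (point b))"
proof -
  have "trajectory step (point b 0) = point b"
    by (auto simp: trajectory_point)
  moreover have "point b L = point b 0" by (simp add: point_eq_iff)
  ultimately show ?thesis
    unfolding attractor_def using L_pos point_in_states by metis
qed

lemma card_cycle: "card (range (point b)) = L"
proof -
  have "inj_on (point b) {..<L}" by (auto simp: inj_on_def point_eq_iff)
  then show ?thesis by (simp add: range_point card_image)
qed

lemma cycle_states_eq: "cycle_states = range (point False) \<union> range (point True)"
  by (auto simp: cycle_states_def) (metis (full_types) rangeI)

lemma card_cycle_states: "card cycle_states \<le> 2 * L"
  using card_Un_le[of "range (point False)" "range (point True)"]
  by (simp add: cycle_states_eq card_cycle)

lemma reaches_cycle: "\<exists>b. reaches step s (range (point b))"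
proof (cases "s \<in> cycle_states")
  case True
  then obtain b k where "trajectory step s 0 = point b k"
    by (auto simp: cycle_states_def trajectory_def)
  then show ?thesis unfolding reaches_def by blast
next
  case False
  then show ?thesis unfolding reaches_def by (metis rangeI trajectory_off_cycles)
qed

lemma chaotic_step:
  assumes "p < 1" "c ^ N < real L"
  shows "chaotic p c N step"
proof -
  have "{s. \<exists>A. attractor N step A \<and> reaches step s A \<and> real (card A) > c ^ N} = UNIV"
    using attractor_cycle reaches_cycle card_cycle assms(2) by auto metis
  then show ?thesis using assms(1) by (simp add: chaotic_def)
qed

section \<open>Decoherence\<close>

lemma hamming_points: "b' \<longleftrightarrow> \<not> b \<Longrightarrow> hamming N (point b k) (point b' k) = N"
  by (simp add: point_def hamming_complement)

text \<open>
  This is the mechanism of decoherence: the flip changes the parity, hence the cycle that is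
  entered. Both trajectories enter at the starting point, so they stay in step.
\<close>

lemma hamming_trajectories:
  assumes "i \<in> {1..N}" "s \<notin> cycle_states" "flip i s \<notin> cycle_states"
  shows "hamming N (trajectory step s (Suc t)) (trajectory step (flip i s) (Suc t)) = N"
  using assms by (simp add: trajectory_off_cycles odd_parity_flip hamming_points)

lemma eventually_far_apart:
  assumes i: "i \<in> {1..N}" "s \<notin> cycle_states" "flip i s \<notin> cycle_states"
    and \<alpha>: "\<alpha> \<le> 1" and q: "q < 1"
  shows "\<forall>\<^sub>F T in sequentially. far_apart_proportion \<alpha> N step s (flip i s) T \<ge> q"
proof -
  \<comment> \<open>At time \<open>0\<close> the distance is only \<open>1\<close>, so this one of the \<open>T + 1\<close> times is given up.\<close>
  have bound: "far_apart_proportion \<alpha> N step s (flip i s) T \<ge> real T / (real T + 1)" for T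
  proof -
    let ?F = "{t \<in> {0..T}. real (hamming N (trajectory step s t) (trajectory step (flip i s) t))
                 \<ge> \<alpha> * real N}"
    have "{1..T} \<subseteq> ?F"
    proof
      fix t assume t: "t \<in> {1..T}"
      then obtain t' where "t = Suc t'" by (cases t) auto
      moreover have "\<alpha> * real N \<le> real N"
        using mult_right_mono[OF \<alpha>, of "real N"] by simp
      ultimately show "t \<in> ?F"
        using t hamming_trajectories[OF i, of t'] by simp
    qed
    then have "card {1..T} \<le> card ?F" by (intro card_mono) auto
    then have "real T \<le> real (card ?F)" by simp
    then show ?thesis
      by (simp add: far_apart_proportion_def divide_right_mono add.commute)
  qed
  have "(\<lambda>T. real T / (real T + 1)) \<longlonglongrightarrow> 1" by real_asymp
  then have "\<forall>\<^sub>F T in sequentially. q < real T / (real T + 1)"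
    using q by (rule order_tendstoD(1))
  then show ?thesis
    by eventually_elim (use bound in \<open>smt (verit)\<close>)
qed

text \<open>
  For a fixed coordinate the flip is injective, so the pairs whose flipped state lies on a cycle
  are as few as those whose original state does. This is the union bound over the two kinds.
\<close>

lemma prob_off_cycles:
  "measure_pmf.prob (random_state_and_coordinate N)
     {(s, i). i \<in> {1..N} \<and> s \<notin> cycle_states \<and> flip i s \<notin> cycle_states}
     \<ge> 1 - 4 * real L / 2 ^ N" (is "measure_pmf.prob _ ?G \<ge> _")
proof -
  let ?S = "states N \<times> {1..N}" and ?B = "cycle_states \<times> {1..N}"
  let ?h = "\<lambda>(s, i). (flip i s, i)"
  have fin: "finite cycle_states"
    by (simp add: cycle_states_eq range_point)
  have "card (?S - ?G) \<le> card (?B \<union> ?h ` ?B)"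
  proof (rule card_mono)
    show "finite (?B \<union> ?h ` ?B)" using fin by simp
    show "?S - ?G \<subseteq> ?B \<union> ?h ` ?B"
    proof
      fix x assume "x \<in> ?S - ?G"
      then obtain s i where x: "x = (s, i)" "i \<in> {1..N}"
        and "s \<in> cycle_states \<or> flip i s \<in> cycle_states" by auto
      moreover have "x = ?h (flip i s, i)" using x by simp
      ultimately show "x \<in> ?B \<union> ?h ` ?B" by blast
    qed
  qed
  also have "\<dots> \<le> card ?B + card ?B"
    using card_Un_le[of ?B "?h ` ?B"] card_image_le[of ?B ?h] fin by simp
  also have "\<dots> \<le> 4 * L * N"
    using mult_le_mono1[OF card_cycle_states, of N]
    unfolding card_cartesian_product card_atLeastAtMost diff_Suc_1 by linarith
  finally have bad: "card (?S - ?G) \<le> 4 * L * N" .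
  have "card (?S \<inter> ?G) + card (?S - ?G) = card ?S"
    by (rule card_Int_Diff[symmetric]) simp
  then have "card ?S \<le> card (?S \<inter> ?G) + 4 * L * N" using bad by linarith
  then have "real (2 ^ N * N) \<le> real (card (?S \<inter> ?G) + 4 * L * N)"
    by (simp only: card_cartesian_product card_states of_nat_le_iff) simp
  then have "real (2 ^ N * N) - 4 * real L * real N \<le> real (card (?S \<inter> ?G))"
    by simp
  then have "(real (2 ^ N * N) - 4 * real L * real N) / real (2 ^ N * N)
      \<le> real (card (?S \<inter> ?G)) / real (2 ^ N * N)"
    by (rule divide_right_mono) simp
  moreover have "(real (2 ^ N * N) - 4 * real L * real N) / real (2 ^ N * N) = 1 - 4 * real L / 2 ^ N"
    using N_pos by (simp add: field_simps)
  moreover have "random_state_and_coordinate N = pmf_of_set ?S"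
    using N_pos unfolding random_state_and_coordinate_def random_state_def
    by (intro pmf_eqI) (auto simp: pmf_pair indicator_def card_cartesian_product split: prod.split)
  ultimately show ?thesis
    using N_pos by (simp add: measure_pmf_of_set card_cartesian_product card_states)
qed

lemma decoherent_step:
  assumes "\<alpha> \<le> 1" "q < 1" "4 * real L / 2 ^ N \<le> 1 - p"
  shows "decoherent p \<alpha> q N step"
proof -
  have "p \<le> 1 - 4 * real L / 2 ^ N" using assms(3) by simp
  also note prob_off_cycles
  also have "measure_pmf.prob (random_state_and_coordinate N)
     {(s, i). i \<in> {1..N} \<and> s \<notin> cycle_states \<and> flip i s \<notin> cycle_states}
     \<le> measure_pmf.prob (random_state_and_coordinate N)
       {(s, i). \<forall>\<^sub>F T in sequentially. far_apart_proportion \<alpha> N step s (flip i s) T \<ge> q}"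
    using eventually_far_apart assms(1,2) by (intro measure_pmf.finite_measure_mono) auto
  finally show ?thesis by (simp add: decoherent_def)
qed

end

section \<open>Long cycles that occupy few states\<close>

lemma twin_cycles_exist:
  assumes "N \<ge> 1" "L > 0" "2 * L \<le> 2 ^ N"
  shows "\<exists>e. twin_cycles N L e"
proof -
  let ?H = "{s \<in> states N. \<not> s 1}"
  have "L \<le> card ?H" using card_states_first_false[OF assms(1)] assms(3) by linarith
  then obtain e where "inj_on e {..<L}" "e ` {..<L} \<subseteq> ?H"
    using card_le_inj[of "{..<L}" ?H] by auto
  then have "twin_cycles N L e"
    using assms(1,2) unfolding twin_cycles_def by (auto simp: image_subset_iff)
  then show ?thesis by blast
qed

theorem proposition3p5:
  fixes \<alpha> p q c :: real
  assumes "0 < \<alpha>" "\<alpha> < 1" "0 < p" "p < 1" "0 < q" "q < 1" "1 < c" "c < 2"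
  shows "\<exists>N0. \<forall>N\<ge>N0. \<exists>f. boolean_network N f \<and> chaotic p c N f \<and> decoherent p \<alpha> q N f"
proof -
  have "(\<lambda>N. 4 * ((c / 2) ^ N + (1 / 2) ^ N)) \<longlonglongrightarrow> 4 * (0 + 0)"
    using assms by (intro tendsto_intros LIMSEQ_realpow_zero) auto
  then have "\<forall>\<^sub>F N in sequentially. 4 * ((c / 2) ^ N + (1 / 2) ^ N) < 1 - p"
    by (rule order_tendstoD(2)) (use assms in simp)
  then have "\<forall>\<^sub>F N in sequentially.
      \<exists>f. boolean_network N f \<and> chaotic p c N f \<and> decoherent p \<alpha> q N f"
    using eventually_ge_at_top[of "1::nat"]
  proof eventually_elim
    case (elim N)
    define L where "L = nat \<lfloor>c ^ N\<rfloor> + 1"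
    have "c ^ N \<ge> 0" using assms by simp
    then have L: "c ^ N < real L" "real L \<le> c ^ N + 1" "L > 0"
      unfolding L_def by linarith+
    then have "4 * real L / 2 ^ N \<le> 4 * (c ^ N + 1) / 2 ^ N"
      by (intro divide_right_mono) auto
    also have "\<dots> = 4 * ((c / 2) ^ N + (1 / 2) ^ N)"
      by (simp add: power_divide add_divide_distrib)
    finally have few: "4 * real L / 2 ^ N \<le> 1 - p" using elim(1) by linarith
    then have "4 * real L / 2 ^ N \<le> 1" using assms by linarith
    then have "real (4 * L) \<le> real (2 ^ N)" by (simp add: field_simps)
    then have "2 * L \<le> 2 ^ N" unfolding of_nat_le_iff by linarith
    then obtain e where "twin_cycles N L e"
      using twin_cycles_exist elim(2) L(3) by blast
    then interpret twin_cycles N L e .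
    show ?case
      using boolean_network_step chaotic_step[OF assms(4) L(1)] decoherent_step[OF _ assms(6) few]
        assms(2) by (meson less_imp_le)
  qed
  then show ?thesis by (simp add: eventually_sequentially)
qed

end
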